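(* Let $(A,\cdot,\ast,\alpha)$ be a multiplicative admissible Hom-Novikov-Poisson algebra and let $a\in A$ be an element such that $\alpha^2(a)=a$. Then the multiplicative Hom-Novikov-Poisson algebra $A'=(A,\diamond,\ast_\alpha,\alpha^2)$, where \[ x\diamond y=a\cdot(x\cdot y),\qquad x\ast_\alpha y=\alpha(x\ast y)=\alpha(x)\ast\alpha(y) \] for all $x,y\in A$, is also admissible.
   Context: Everything is over a fixed field $\mathbf{k}$ of characteristic $0$. A double Hom-algebra is a quadruple $(A,\cdot,\ast,\alpha)$ where $A$ is a $\mathbf{k}$-vector space, $\cdot$ and $\ast$ are bilinear operations $A\otimes A\to A$, and $\alpha\colon A\to A$ is a linear map (the twisting map). It is multiplicative if $\alpha(x\cdot y)=\alpha(x)\cdot\alpha(y)$ and $\alpha(x\ast y)=\alpha(x)\ast\alpha(y)$ for all $x,y$. $\alpha^n$ denotes the $n$-fold composition of $\alpha$. A Hom-Novikov-Poisson algebra is a double Hom-algebra $(A,\cdot,\ast,\alpha)$ such that for all $x,y,z\in A$: (1) $(A,\cdot,\alpha)$ is a commutative Hom-associative algebra: $x\cdot y=y\cdot x$ and $(x\cdot y)\cdot\alpha(z)=\alpha(x)\cdot(y\cdot z)$; (2) $(A,\ast,\alpha)$ is a Hom-Novikov algebra: $(x\ast y)\ast\alpha(z)-\alpha(x)\ast(y\ast z)=(y\ast x)\ast\alpha(z)-\alpha(y)\ast(x\ast z)$ and $(x\ast y)\ast\alpha(z)=(x\ast z)\ast\alpha(y)$; (3) $(x\ast y)\cdot\alpha(z)-\alpha(x)\ast(y\cdot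 z)=(y\ast x)\cdot\alpha(z)-\alpha(y)\ast(x\cdot z)$; (4) $(x\cdot y)\ast\alpha(z)=(x\ast z)\cdot\alpha(y)$. It is a result of the paper that $A'$ in the claim is a multiplicative Hom-Novikov-Poisson algebra whenever $A$ is one and $\alpha^2(a)=a$. A Hom-Lie algebra $(A,[,],\alpha)$ is a vector space with a bilinear anti-symmetric bracket and a linear map $\alpha$ satisfying the Hom-Jacobi identity $[[x,y],\alpha(z)]+[[z,x],\alpha(y)]+[[y,z],\alpha(x)]=0$. A Hom-Poisson algebra $(A,\cdot,[,],\alpha)$ consists of a commutative Hom-associative algebra $(A,\cdot,\alpha)$ and a Hom-Lie algebra $(A,[,],\alpha)$ such that the Hom-Leibniz identity $[\alpha(x),y\cdot z]=[x,y]\cdot\alpha(z)+\alpha(y)\cdot[x,z]$ holds for all $x,y,z\in A$. A Hom-Novikov-Poisson algebra $(A,\cdot,\ast,\alpha)$ is admissible if $A^-=(A,\cdot,[,],\alpha)$ is a Hom-Poisson algebra, where $[x,y]=x\ast y-y\ast x$. *)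

theory Defs
  imports Complex_Main
begin

locale hom_algebra = vector_space scale
  for scale :: "'k::field_char_0 \<Rightarrow> 'a::ab_group_add \<Rightarrow> 'a" (infixr \<open>*s\<close> 75) +
  fixes mult :: "'a \<Rightarrow> 'a \<Rightarrow> 'a"
    and \<alpha> :: "'a \<Rightarrow> 'a"
  assumes linear_left: "Vector_Spaces.linear (*s) (*s) (\<lambda>x. mult x y)"
    and linear_right: "Vector_Spaces.linear (*s) (*s) (\<lambda>y. mult x y)"
    and linear_twist: "Vector_Spaces.linear (*s) (*s) \<alpha>"

locale comm_hom_associative_algebra = hom_algebra scale dot \<alpha>
  for scale :: "'k::field_char_0 \<Rightarrow> 'a::ab_group_add \<Rightarrow> 'a"
    and dot :: "'a \<Rightarrow> 'a \<Rightarrow> 'a" (infixl \<open>\<cdot>\<close> 70)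
    and \<alpha> :: "'a \<Rightarrow> 'a" +
  assumes commutative: "x \<cdot> y = y \<cdot> x"
    and hom_associative: "(x \<cdot> y) \<cdot> \<alpha> z = \<alpha> x \<cdot> (y \<cdot> z)"

locale hom_novikov_algebra = hom_algebra scale star \<alpha>
  for scale :: "'k::field_char_0 \<Rightarrow> 'a::ab_group_add \<Rightarrow> 'a"
    and star :: "'a \<Rightarrow> 'a \<Rightarrow> 'a" (infixl \<open>\<star>\<close> 70)
    and \<alpha> :: "'a \<Rightarrow> 'a" +
  assumes hom_left_symmetric:
      "(x \<star> y) \<star> \<alpha> z - \<alpha> x \<star> (y \<star> z) = (y \<star> x) \<star> \<alpha> z - \<alpha> y \<star> (x \<star> z)"
    and hom_right_commutative: "(x \<star> y) \<star> \<alpha> z = (x \<star> z) \<star> \<alpha> y"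

locale hom_lie_algebra = hom_algebra scale bracket \<alpha>
  for scale :: "'k::field_char_0 \<Rightarrow> 'a::ab_group_add \<Rightarrow> 'a"
    and bracket :: "'a \<Rightarrow> 'a \<Rightarrow> 'a"
    and \<alpha> :: "'a \<Rightarrow> 'a" +
  assumes antisymmetric: "bracket x y = - bracket y x"
    and hom_jacobi:
      "bracket (bracket x y) (\<alpha> z) + bracket (bracket z x) (\<alpha> y)
        + bracket (bracket y z) (\<alpha> x) = 0"

locale double_hom_algebra =
  dot: hom_algebra scale dot \<alpha> + star: hom_algebra scale star \<alpha>
  for scale :: "'k::field_char_0 \<Rightarrow> 'a::ab_group_add \<Rightarrow> 'a"
    and dot :: "'a \<Rightarrow> 'a \<Rightarrow> 'a" (infixl \<open>\<cdot>\<close> 70)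
    and star :: "'a \<Rightarrow> 'a \<Rightarrow> 'a" (infixl \<open>\<star>\<close> 70)
    and \<alpha> :: "'a \<Rightarrow> 'a"

locale multiplicative_double_hom_algebra = double_hom_algebra scale dot star \<alpha>
  for scale :: "'k::field_char_0 \<Rightarrow> 'a::ab_group_add \<Rightarrow> 'a"
    and dot :: "'a \<Rightarrow> 'a \<Rightarrow> 'a" (infixl \<open>\<cdot>\<close> 70)
    and star :: "'a \<Rightarrow> 'a \<Rightarrow> 'a" (infixl \<open>\<star>\<close> 70)
    and \<alpha> :: "'a \<Rightarrow> 'a" +
  assumes twist_dot: "\<alpha> (x \<cdot> y) = \<alpha> x \<cdot> \<alpha> y"
    and twist_star: "\<alpha> (x \<star> y) = \<alpha> x \<star> \<alpha> y"

locale hom_novikov_poisson_algebra =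
  double_hom_algebra scale dot star \<alpha> +
  dot: comm_hom_associative_algebra scale dot \<alpha> +
  star: hom_novikov_algebra scale star \<alpha>
  for scale :: "'k::field_char_0 \<Rightarrow> 'a::ab_group_add \<Rightarrow> 'a"
    and dot :: "'a \<Rightarrow> 'a \<Rightarrow> 'a" (infixl \<open>\<cdot>\<close> 70)
    and star :: "'a \<Rightarrow> 'a \<Rightarrow> 'a" (infixl \<open>\<star>\<close> 70)
    and \<alpha> :: "'a \<Rightarrow> 'a" +
  assumes left_symmetric_compat:
      "(x \<star> y) \<cdot> \<alpha> z - \<alpha> x \<star> (y \<cdot> z) = (y \<star> x) \<cdot> \<alpha> z - \<alpha> y \<star> (x \<cdot> z)"
    and right_commutative_compat: "(x \<cdot> y) \<star> \<alpha> z = (x \<star> z) \<cdot> \<alpha> y"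

locale hom_poisson_algebra =
  dot: comm_hom_associative_algebra scale dot \<alpha> +
  bracket: hom_lie_algebra scale bracket \<alpha>
  for scale :: "'k::field_char_0 \<Rightarrow> 'a::ab_group_add \<Rightarrow> 'a"
    and dot :: "'a \<Rightarrow> 'a \<Rightarrow> 'a" (infixl \<open>\<cdot>\<close> 70)
    and bracket :: "'a \<Rightarrow> 'a \<Rightarrow> 'a"
    and \<alpha> :: "'a \<Rightarrow> 'a" +
  assumes hom_leibniz:
    "bracket (\<alpha> x) (y \<cdot> z) = bracket x y \<cdot> \<alpha> z + \<alpha> y \<cdot> bracket x z"

locale admissible_hom_novikov_poisson_algebra =
  hom_novikov_poisson_algebra scale dot star \<alpha> +
  minus: hom_poisson_algebra scale dot "\<lambda>x y. star x y - star y x" \<alpha>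
  for scale :: "'k::field_char_0 \<Rightarrow> 'a::ab_group_add \<Rightarrow> 'a"
    and dot :: "'a \<Rightarrow> 'a \<Rightarrow> 'a" (infixl \<open>\<cdot>\<close> 70)
    and star :: "'a \<Rightarrow> 'a \<Rightarrow> 'a" (infixl \<open>\<star>\<close> 70)
    and \<alpha> :: "'a \<Rightarrow> 'a"

end

theory Submission
  imports Defs
begin

text \<open>
  Everything rests on a description of admissibility by one identity: a Hom-Novikov-Poisson
  algebra is admissible iff \<open>\<alpha>(x) \<star> (y \<cdot> z) = (x \<star> y) \<cdot> \<alpha>(z)\<close>.  To see this, consider the
  trilinear map \<open>P(x, y, z) = (x \<star> z) \<cdot> \<alpha>(y)\<close>.  Right compatibility says that it equals
  \<open>(x \<cdot> y) \<star> \<alpha>(z)\<close>, so it is always symmetric in \<open>x\<close> and \<open>y\<close>.  The Hom-Leibniz identity becomes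
  \<open>\<alpha>(x) \<star> (y \<cdot> z) = P(x, z, y) + P(x, y, z) - P(z, y, x)\<close>, and substituting this into the left
  compatibility makes \<open>P\<close> totally symmetric; the last two terms then cancel.  Conversely, the
  identity and commutativity of \<open>\<cdot>\<close> make \<open>P\<close> totally symmetric, which gives back
  Hom-Leibniz.  The other half of admissibility is free, since the commutator of a
  Hom-left-symmetric product always satisfies the Hom-Jacobi identity.

  In the twisted algebra both sides of the corresponding identity are values of \<open>P\<close> at permutations
  of \<open>\<alpha>\<^sup>2(x)\<close>, \<open>\<alpha>(a)\<close> and \<open>\<alpha>(y) \<cdot> \<alpha>(z)\<close>, because \<open>a = \<alpha>(\<alpha>(a))\<close>.  Total symmetry of \<open>P\<close>
  therefore proves it, and the left compatibility of the twisted algebra follows because both of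
  its sides then vanish.
\<close>

section \<open>Bilinearity of derived products\<close>

context hom_algebra
begin

lemma mult_diff_left: "mult (x - y) z = mult x z - mult y z"
  using linear_left[of z, THEN Vector_Spaces.linear.axioms(3), THEN module_hom.diff] .

lemma mult_diff_right: "mult x (y - z) = mult x y - mult x z"
  using linear_right[of x, THEN Vector_Spaces.linear.axioms(3), THEN module_hom.diff] .

lemma twist_diff: "\<alpha> (x - y) = \<alpha> x - \<alpha> y"
  using linear_twist[THEN Vector_Spaces.linear.axioms(3), THEN module_hom.diff] .

lemma commutator_hom_algebra: "hom_algebra scale (\<lambda>x y. mult x y - mult y x) \<alpha>"
proof -
  interpret vector_space_pair scale scale ..
  show ?thesis
    by (intro hom_algebra.intro hom_algebra_axioms.intro vector_space_axioms
        linear_compose_sub linear_left linear_right linear_twist)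
qed

lemma linear_square_twist: "Vector_Spaces.linear scale scale (\<alpha> ^^ 2)"
  using Vector_Spaces.linear_compose[OF linear_twist linear_twist] by (simp add: numeral_2_eq_2)

lemma twisted_product_hom_algebra: "hom_algebra scale (\<lambda>x y. \<alpha> (mult x y)) (\<alpha> ^^ 2)"
  by (intro hom_algebra.intro hom_algebra_axioms.intro vector_space_axioms linear_square_twist
      Vector_Spaces.linear_compose[OF linear_left linear_twist, unfolded comp_def]
      Vector_Spaces.linear_compose[OF linear_right linear_twist, unfolded comp_def])

lemma left_multiple_hom_algebra: "hom_algebra scale (\<lambda>x y. mult a (mult x y)) (\<alpha> ^^ 2)"
  by (intro hom_algebra.intro hom_algebra_axioms.intro vector_space_axioms linear_square_twist
      Vector_Spaces.linear_compose[OF linear_left linear_right, unfolded comp_def]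
      Vector_Spaces.linear_compose[OF linear_right linear_right, unfolded comp_def])

end

section \<open>Admissibility as a single identity\<close>

lemma (in hom_novikov_algebra) commutator_hom_lie:
  "hom_lie_algebra scale (\<lambda>x y. x \<star> y - y \<star> x) \<alpha>"
proof (intro hom_lie_algebra.intro commutator_hom_algebra hom_lie_algebra_axioms.intro)
  fix x y z
  show "x \<star> y - y \<star> x = - (y \<star> x - x \<star> y)" by simp
  let ?d = "\<lambda>u v w. ((u \<star> v) \<star> \<alpha> w - \<alpha> u \<star> (v \<star> w)) - ((v \<star> u) \<star> \<alpha> w - \<alpha> v \<star> (u \<star> w))"
  have "(x \<star> y - y \<star> x) \<star> \<alpha> z - \<alpha> z \<star> (x \<star> y - y \<star> x)
      + ((z \<star> x - x \<star> z) \<star> \<alpha> y - \<alpha> y \<star> (z \<star> x - x \<star> z))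
      + ((y \<star> z - z \<star> y) \<star> \<alpha> x - \<alpha> x \<star> (y \<star> z - z \<star> y)) = ?d x y z + ?d y z x + ?d z x y"
    by (simp add: mult_diff_left mult_diff_right algebra_simps)
  also have "\<dots> = 0"
    by (simp add: hom_left_symmetric[of x y z] hom_left_symmetric[of y z x]
        hom_left_symmetric[of z x y])
  finally show "(x \<star> y - y \<star> x) \<star> \<alpha> z - \<alpha> z \<star> (x \<star> y - y \<star> x)
      + ((z \<star> x - x \<star> z) \<star> \<alpha> y - \<alpha> y \<star> (z \<star> x - x \<star> z))
      + ((y \<star> z - z \<star> y) \<star> \<alpha> x - \<alpha> x \<star> (y \<star> z - z \<star> y)) = 0" .
qed

context hom_novikov_poisson_algebra
begin

lemma star_dot_twist_swap: "(x \<star> z) \<cdot> \<alpha> y = (y \<star> z) \<cdot> \<alpha> x"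
  by (metis right_commutative_compat dot.commutative)

text \<open>
  Together with the swap of \<open>x\<close> and \<open>y\<close>, which always holds, invariance of \<open>(x \<star> z) \<cdot> \<alpha> y\<close> under
  the swap of \<open>y\<close> and \<open>z\<close> is total symmetry.  That swap is commutativity
  of the inner product \<open>y \<cdot> z\<close>, read through the assumed identity.
\<close>

lemma admissible_if_star_dot:
  assumes star_dot: "\<And>x y z. \<alpha> x \<star> (y \<cdot> z) = (x \<star> y) \<cdot> \<alpha> z"
  shows "admissible_hom_novikov_poisson_algebra scale dot star \<alpha>"
proof -
  have total: "(x \<star> z) \<cdot> \<alpha> y = (z \<star> x) \<cdot> \<alpha> y" for x y z
    by (metis star_dot dot.commutative star_dot_twist_swap)
  have leibniz: "\<alpha> x \<star> (y \<cdot> z) - (y \<cdot> z) \<star> \<alpha> x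
      = (x \<star> y - y \<star> x) \<cdot> \<alpha> z + \<alpha> y \<cdot> (x \<star> z - z \<star> x)" for x y z
  proof -
    have "\<alpha> y \<cdot> (x \<star> z - z \<star> x) = 0"
      using total[of x z y] by (simp add: dot.mult_diff_right dot.commutative)
    then show ?thesis
      by (simp add: star_dot right_commutative_compat dot.mult_diff_left)
  qed
  interpret bracket: hom_lie_algebra scale "\<lambda>x y. x \<star> y - y \<star> x" \<alpha>
    by (rule star.commutator_hom_lie)
  show ?thesis
    by unfold_locales (rule leibniz)
qed

end

context admissible_hom_novikov_poisson_algebra
begin

lemma twist_star_dot_expand:
  "\<alpha> x \<star> (y \<cdot> z) = (x \<star> y) \<cdot> \<alpha> z + (x \<star> z) \<cdot> \<alpha> y - (z \<star> x) \<cdot> \<alpha> y"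
  using minus.hom_leibniz[of x y z] right_commutative_compat[of y z x]
  by (simp add: dot.mult_diff_left dot.mult_diff_right dot.commutative[of "\<alpha> y"] algebra_simps)

text \<open>
  Left compatibility removes the first term in the expansion of \<open>\<alpha> x \<star> (y \<cdot> z)\<close> and says that
  the difference of the other two is symmetric in \<open>x\<close> and \<open>y\<close>; the first of these two is symmetric already.
\<close>

lemma star_dot_twist_swap_right: "(z \<star> x) \<cdot> \<alpha> y = (z \<star> y) \<cdot> \<alpha> x"
  using left_symmetric_compat[of x y z] star_dot_twist_swap[of x z y]
  by (simp add: twist_star_dot_expand)

lemma star_dot: "\<alpha> x \<star> (y \<cdot> z) = (x \<star> y) \<cdot> \<alpha> z"
proof -
  have "(x \<star> z) \<cdot> \<alpha> y = (z \<star> x) \<cdot> \<alpha> y"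
    by (metis star_dot_twist_swap star_dot_twist_swap_right)
  then show ?thesis
    by (simp add: twist_star_dot_expand)
qed

end

section \<open>Twisting an admissible algebra\<close>

locale multiplicative_admissible_hom_novikov_poisson_algebra =
  multiplicative_double_hom_algebra scale dot star \<alpha> +
  admissible_hom_novikov_poisson_algebra scale dot star \<alpha>
  for scale :: "'k::field_char_0 \<Rightarrow> 'a::ab_group_add \<Rightarrow> 'a"
    and dot :: "'a \<Rightarrow> 'a \<Rightarrow> 'a" (infixl \<open>\<cdot>\<close> 70)
    and star :: "'a \<Rightarrow> 'a \<Rightarrow> 'a" (infixl \<open>\<star>\<close> 70)
    and \<alpha> :: "'a \<Rightarrow> 'a"
begin

lemma twist_twice: "(\<alpha> ^^ 2) x = \<alpha> (\<alpha> x)"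
  by (simp add: numeral_2_eq_2)

text \<open>
  Moving \<open>a\<close> outwards costs one twist, and both bracketings lead to \<open>\<alpha> a \<cdot> (\<alpha> x \<cdot> (y \<cdot> z))\<close>
  under the outer factor \<open>a\<close>.
\<close>

lemma left_multiple_comm_hom_associative:
  "comm_hom_associative_algebra scale (\<lambda>x y. a \<cdot> (x \<cdot> y)) (\<alpha> ^^ 2)"
proof (intro comm_hom_associative_algebra.intro dot.left_multiple_hom_algebra
    comm_hom_associative_algebra_axioms.intro)
  fix x y z
  show "a \<cdot> (x \<cdot> y) = a \<cdot> (y \<cdot> x)" by (simp add: dot.commutative)
  have "(a \<cdot> (x \<cdot> y)) \<cdot> \<alpha> (\<alpha> z) = \<alpha> a \<cdot> (\<alpha> x \<cdot> (y \<cdot> z))"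
    by (simp add: dot.hom_associative)
  also have "\<dots> = (a \<cdot> \<alpha> x) \<cdot> \<alpha> (y \<cdot> z)"
    by (simp add: dot.hom_associative)
  also have "\<dots> = \<alpha> (\<alpha> x) \<cdot> (a \<cdot> (y \<cdot> z))"
    by (metis dot.commutative dot.hom_associative)
  finally show "a \<cdot> ((a \<cdot> (x \<cdot> y)) \<cdot> (\<alpha> ^^ 2) z) = a \<cdot> ((\<alpha> ^^ 2) x \<cdot> (a \<cdot> (y \<cdot> z)))"
    by (simp add: twist_twice)
qed

text \<open>
  By multiplicativity, every cubic term of the twisted product is \<open>\<alpha>\<^sup>2\<close> of the same term of the
  original product, so the axioms are the images of the old ones under a linear map.
\<close>

lemma twisted_star_hom_novikov: "hom_novikov_algebra scale (\<lambda>x y. \<alpha> (x \<star> y)) (\<alpha> ^^ 2)"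
proof -
  have left: "\<alpha> (\<alpha> (x \<star> y) \<star> (\<alpha> ^^ 2) z) = \<alpha> (\<alpha> ((x \<star> y) \<star> \<alpha> z))"
    and right: "\<alpha> ((\<alpha> ^^ 2) x \<star> \<alpha> (y \<star> z)) = \<alpha> (\<alpha> (\<alpha> x \<star> (y \<star> z)))" for x y z
    by (simp_all add: twist_star twist_twice)
  show ?thesis
  proof (intro hom_novikov_algebra.intro star.twisted_product_hom_algebra
      hom_novikov_algebra_axioms.intro)
    fix x y z
    show "\<alpha> (\<alpha> (x \<star> y) \<star> (\<alpha> ^^ 2) z) - \<alpha> ((\<alpha> ^^ 2) x \<star> \<alpha> (y \<star> z))
        = \<alpha> (\<alpha> (y \<star> x) \<star> (\<alpha> ^^ 2) z) - \<alpha> ((\<alpha> ^^ 2) y \<star> \<alpha> (x \<star> z))"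
      unfolding left right star.twist_diff[symmetric] by (simp only: star.hom_left_symmetric)
    show "\<alpha> (\<alpha> (x \<star> y) \<star> (\<alpha> ^^ 2) z) = \<alpha> (\<alpha> (x \<star> z) \<star> (\<alpha> ^^ 2) y)"
      unfolding left by (simp only: star.hom_right_commutative)
  qed
qed

context
  fixes a
  assumes fixed: "\<alpha> (\<alpha> a) = a"
begin

lemma twisted_multiplicative:
  "multiplicative_double_hom_algebra scale (\<lambda>x y. a \<cdot> (x \<cdot> y)) (\<lambda>x y. \<alpha> (x \<star> y)) (\<alpha> ^^ 2)"
  by (intro multiplicative_double_hom_algebra.intro double_hom_algebra.intro
      multiplicative_double_hom_algebra_axioms.intro
      dot.left_multiple_hom_algebra star.twisted_product_hom_algebra)
    (simp_all add: twist_dot twist_star twist_twice fixed)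

text \<open>
  Writing the outer factor \<open>a\<close> as \<open>\<alpha> (\<alpha> a)\<close> lets it be exchanged with \<open>\<alpha> y \<cdot> \<alpha> z\<close> by the total
  symmetry of the trilinear map \<open>(x \<star> z) \<cdot> \<alpha> y\<close>.
\<close>

lemma twisted_star_dot:
  "\<alpha> ((\<alpha> ^^ 2) x \<star> (a \<cdot> (y \<cdot> z))) = a \<cdot> (\<alpha> (x \<star> y) \<cdot> (\<alpha> ^^ 2) z)"
proof -
  have "\<alpha> ((\<alpha> ^^ 2) x \<star> (a \<cdot> (y \<cdot> z))) = \<alpha> (\<alpha> (\<alpha> x)) \<star> (\<alpha> a \<cdot> (\<alpha> y \<cdot> \<alpha> z))"
    by (simp add: twist_star twist_dot twist_twice)
  also have "\<dots> = (\<alpha> (\<alpha> x) \<star> \<alpha> a) \<cdot> \<alpha> (\<alpha> y \<cdot> \<alpha> z)"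
    by (rule star_dot)
  also have "\<dots> = (\<alpha> (\<alpha> x) \<star> (\<alpha> y \<cdot> \<alpha> z)) \<cdot> \<alpha> (\<alpha> a)"
    by (rule star_dot_twist_swap_right)
  also have "\<dots> = a \<cdot> ((\<alpha> x \<star> \<alpha> y) \<cdot> \<alpha> (\<alpha> z))"
    by (simp add: star_dot fixed dot.commutative)
  finally show ?thesis
    by (simp add: twist_star twist_twice)
qed

lemma twisted_right_compat:
  "\<alpha> ((a \<cdot> (x \<cdot> y)) \<star> (\<alpha> ^^ 2) z) = a \<cdot> (\<alpha> (x \<star> z) \<cdot> (\<alpha> ^^ 2) y)"
proof -
  have "\<alpha> ((a \<cdot> (x \<cdot> y)) \<star> (\<alpha> ^^ 2) z) = ((\<alpha> x \<cdot> \<alpha> y) \<cdot> \<alpha> a) \<star> \<alpha> (\<alpha> (\<alpha> z))"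
    by (simp add: twist_star twist_dot twist_twice dot.commutative)
  also have "\<dots> = ((\<alpha> x \<cdot> \<alpha> y) \<star> \<alpha> (\<alpha> z)) \<cdot> \<alpha> (\<alpha> a)"
    by (metis right_commutative_compat dot.commutative)
  finally show ?thesis
    by (simp add: right_commutative_compat fixed dot.commutative twist_star twist_twice)
qed

lemma twisted_admissible:
  "admissible_hom_novikov_poisson_algebra scale
    (\<lambda>x y. a \<cdot> (x \<cdot> y)) (\<lambda>x y. \<alpha> (x \<star> y)) (\<alpha> ^^ 2)"
proof -
  have "hom_novikov_poisson_algebra scale (\<lambda>x y. a \<cdot> (x \<cdot> y)) (\<lambda>x y. \<alpha> (x \<star> y)) (\<alpha> ^^ 2)"
    by (intro hom_novikov_poisson_algebra.intro hom_novikov_poisson_algebra_axioms.intro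
        double_hom_algebra.intro dot.left_multiple_hom_algebra star.twisted_product_hom_algebra
        left_multiple_comm_hom_associative twisted_star_hom_novikov twisted_right_compat)
      (simp add: twisted_star_dot)
  then show ?thesis
    by (rule hom_novikov_poisson_algebra.admissible_if_star_dot) (rule twisted_star_dot)
qed

end

end

theorem corollary5p10:
  fixes scale :: "'k::field_char_0 \<Rightarrow> 'a::ab_group_add \<Rightarrow> 'a"
    and dot star :: "'a \<Rightarrow> 'a \<Rightarrow> 'a"
    and \<alpha> :: "'a \<Rightarrow> 'a"
    and a :: 'a
  assumes "multiplicative_double_hom_algebra scale dot star \<alpha>"
    and "admissible_hom_novikov_poisson_algebra scale dot star \<alpha>"
    and "(\<alpha> ^^ 2) a = a"
  shows "multiplicative_double_hom_algebra scale
      (\<lambda>x y. dot a (dot x y)) (\<lambda>x y. \<alpha> (star x y)) (\<alpha> ^^ 2)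
    \<and> admissible_hom_novikov_poisson_algebra scale
      (\<lambda>x y. dot a (dot x y)) (\<lambda>x y. \<alpha> (star x y)) (\<alpha> ^^ 2)"
proof -
  interpret multiplicative_admissible_hom_novikov_poisson_algebra scale dot star \<alpha>
    using assms(1,2) by (rule multiplicative_admissible_hom_novikov_poisson_algebra.intro)
  have "\<alpha> (\<alpha> a) = a"
    using assms(3) by (simp only: twist_twice)
  then show ?thesis
    using twisted_multiplicative twisted_admissible by blast
qed

end
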